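(* Let $q$ be a prime power, let $r$ be a prime number and let $f$ be an irreducible polynomial over $\mathbb{F}_q$ of degree $n$ with $f(0)\ne 0$ such that (i) $f(x)\mid f(x^r)$; (ii) $q$ is a primitive root modulo $r$; (iii) $\gcd(n,r-1)=1$. Then: (a) The polynomial $F(x)=f(x^r)\,(f(x))^{-1}=(f\odot\Phi_r)(x)$ is irreducible over $\mathbb{F}_q$ of degree $n(r-1)$. (b) If $r$ is an odd prime such that $r^2\nmid (q^{r-1}-1)$ and $\gcd(n,r(r-1))=1$, then for every $k\ge 0$ the polynomial $F(x^{r^k})=(f\odot\Phi_{r^{k+1}})(x)$ is irreducible over $\mathbb{F}_q$ of degree $nr^k(r-1)$.
   Context: $\Phi_m$ denotes the $m$-th cyclotomic polynomial, regarded over $\mathbb{F}_q$. For polynomials $f,g$ over $\mathbb{F}_q$ with nonzero roots in the algebraic closure, the composed multiplication is $(f\odot g)(x)=\prod_{\alpha}\prod_{\beta}(x-\alpha\beta)$, where $\alpha$ runs over the roots of $f$ and $\beta$ over the roots of $g$ (with multiplicity). *)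

theory Defs
  imports
    "HOL-Algebra.Algebraic_Closure_Type"
    "HOL-Number_Theory.Residue_Primitive_Roots"
    "HOL-Library.Cardinality"
begin

definition cyclotomic_complex :: "nat \<Rightarrow> complex poly" where
  "cyclotomic_complex m =
     (\<Prod>\<zeta> | \<zeta> ^ m = 1 \<and> (\<forall>d. 0 < d \<and> d < m \<longrightarrow> \<zeta> ^ d \<noteq> 1). [:-\<zeta>, 1:])"

text \<open>
  The following lemma \<open>of_int_cyclotomic\<close> shows that the definite description
  is proper for every \<open>m > 0\<close>.
\<close>
definition cyclotomic :: "nat \<Rightarrow> int poly" where
  "cyclotomic m = (THE p. map_poly of_int p = cyclotomic_complex m)"

lemma map_poly_of_int_mult:
  "map_poly (of_int :: int \<Rightarrow> complex) (p * q) = map_poly of_int p * map_poly of_int q"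
  by (rule poly_eqI) (simp add: coeff_map_poly coeff_mult)

lemma map_poly_of_int_prod:
  "map_poly (of_int :: int \<Rightarrow> complex) (\<Prod>x\<in>A. p x) = (\<Prod>x\<in>A. map_poly of_int (p x))"
  by (induction A rule: infinite_finite_induct) (simp_all add: map_poly_of_int_mult)

lemma map_poly_of_int_diff:
  "map_poly (of_int :: int \<Rightarrow> complex) (p - q) = map_poly of_int p - map_poly of_int q"
  by (rule poly_eqI) (simp add: coeff_map_poly)

lemma map_poly_of_int_inject:
  "map_poly (of_int :: int \<Rightarrow> complex) p = map_poly of_int q \<longleftrightarrow> p = q"
  by (auto simp: poly_eq_iff coeff_map_poly)

lemma degree_map_poly_of_int: "degree (map_poly (of_int :: int \<Rightarrow> complex) p) = degree p"
  by (rule degree_map_poly) auto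

lemma prod_linear_roots_unity:
  assumes "m > 0"
  shows "(\<Prod>\<zeta> | \<zeta> ^ m = 1. [:-\<zeta>, 1:]) = monom (1::complex) m - 1"
proof -
  let ?p = "monom (1::complex) m - 1"
  have roots: "{z. poly ?p z = 0} = {z. z ^ m = 1}"
    by (auto simp: poly_monom)
  have "rsquarefree ?p"
    unfolding rsquarefree_roots
  proof safe
    fix a assume a: "poly ?p a = 0" "poly (pderiv ?p) a = 0"
    then have "a ^ m = 1" "of_nat m * a ^ (m - 1) = 0"
      by (auto simp: poly_monom pderiv_diff pderiv_monom)
    then show False using assms by (auto simp: power_0_left split: if_splits)
  qed
  moreover have "lead_coeff ?p = 1"
  proof -
    have "degree ?p = m"
      using assms by (subst diff_conv_add_uminus, subst degree_add_eq_left) (auto simp: degree_monom_eq)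
    then show ?thesis using assms by simp
  qed
  ultimately show ?thesis
    using complex_poly_decompose_rsquarefree[of ?p] by (simp add: roots del: poly_diff)
qed

lemma prod_cyclotomic_complex:
  assumes "m > 0"
  shows "(\<Prod>d | d dvd m. cyclotomic_complex d) = monom 1 m - 1"
proof -
  define R :: "nat \<Rightarrow> complex set"
    where "R d = {z. z ^ d = 1 \<and> (\<forall>e. 0 < e \<and> e < d \<longrightarrow> z ^ e \<noteq> 1)}" for d
  have fin: "finite {d. d dvd m}" using assms by simp
  have finR: "finite (R d)" if "d dvd m" for d
  proof -
    have "d > 0" using that assms by (auto intro: Nat.gr0I)
    then have "finite {z::complex. z ^ d = 1}" by (intro finite_roots_unity) auto
    then show ?thesis by (rule rev_finite_subset) (auto simp: R_def)
  qed
  have disj: "R d \<inter> R e = {}" if "d dvd m" "e dvd m" "d \<noteq> e" for d e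
  proof -
    have pos: "d > 0" "e > 0" using that assms by (auto intro: Nat.gr0I)
    then show ?thesis using that(3) by (cases "d < e") (auto simp: R_def)
  qed
  have U: "(\<Union>d\<in>{d. d dvd m}. R d) = {z. z ^ m = 1}"
  proof (intro equalityI subsetI)
    fix z assume "z \<in> (\<Union>d\<in>{d. d dvd m}. R d)"
    then show "z \<in> {z. z ^ m = 1}" by (auto simp: R_def dvd_def power_mult)
  next
    fix z :: complex assume z: "z \<in> {z. z ^ m = 1}"
    define d where "d = (LEAST d. 0 < d \<and> z ^ d = 1)"
    have d: "0 < d \<and> z ^ d = 1"
      unfolding d_def by (rule LeastI[of _ m]) (use z assms in auto)
    have min: "z ^ e \<noteq> 1" if "0 < e" "e < d" for e
      using not_less_Least[of e "\<lambda>d. 0 < d \<and> z ^ d = 1"] that by (auto simp: d_def)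
    have "z ^ m = z ^ (d * (m div d) + m mod d)" by simp
    also have "\<dots> = z ^ (m mod d)" using d by (simp only: power_add power_mult) simp
    finally have "z ^ (m mod d) = 1" using z by simp
    then have "m mod d = 0" using min[of "m mod d"] d by (cases "m mod d = 0") auto
    then show "z \<in> (\<Union>d\<in>{d. d dvd m}. R d)" using d min by (auto simp: R_def)
  qed
  have "(\<Prod>d | d dvd m. cyclotomic_complex d) = (\<Prod>d | d dvd m. \<Prod>z\<in>R d. [:-z, 1:])"
    by (simp add: cyclotomic_complex_def R_def)
  also have "\<dots> = (\<Prod>z\<in>(\<Union>d\<in>{d. d dvd m}. R d). [:-z, 1:])"
    by (rule prod.UNION_disjoint[symmetric]) (use fin finR disj in auto)
  finally show ?thesis by (simp add: U prod_linear_roots_unity[OF assms])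
qed

lemma lead_coeff_cyclotomic_complex: "lead_coeff (cyclotomic_complex m) = 1"
  unfolding cyclotomic_complex_def lead_coeff_prod by simp

lemma of_int_cyclotomic:
  assumes "m > 0"
  shows "map_poly of_int (cyclotomic m) = cyclotomic_complex m"
proof -
  have "\<exists>p :: int poly. map_poly of_int p = cyclotomic_complex m"
    using assms
  proof (induction m rule: less_induct)
    case (less m)
    define D where "D = {d. d dvd m \<and> d < m}"
    have D: "{d. d dvd m} = insert m D" "finite D" "m \<notin> D"
      using less.prems by (auto simp: D_def dest: dvd_imp_le)
    have "\<forall>d\<in>D. \<exists>p :: int poly. map_poly of_int p = cyclotomic_complex d"
      using less by (auto simp: D_def intro: Nat.gr0I)
    then obtain c :: "nat \<Rightarrow> int poly"
      where c: "\<And>d. d \<in> D \<Longrightarrow> map_poly of_int (c d) = cyclotomic_complex d" by metis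
    define Q where "Q = (\<Prod>d\<in>D. c d)"
    have Q: "map_poly of_int Q = (\<Prod>d\<in>D. cyclotomic_complex d)"
      by (simp add: Q_def map_poly_of_int_prod c)
    have "lead_coeff (map_poly (of_int :: int \<Rightarrow> complex) Q) = 1"
      unfolding Q lead_coeff_prod by (simp add: lead_coeff_cyclotomic_complex)
    then have lcQ: "lead_coeff Q = 1"
      by (simp add: degree_map_poly_of_int coeff_map_poly)
    then have "Q \<noteq> 0" by auto
    obtain q r where "pseudo_divmod (monom 1 m - 1) Q = (q, r)" by force
    from pseudo_divmod[OF \<open>Q \<noteq> 0\<close> this] lcQ
    have qr: "monom 1 m - 1 = Q * q + r" "r = 0 \<or> degree r < degree Q" by simp_all
    let ?h = "map_poly (of_int :: int \<Rightarrow> complex)"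
    have "?h Q * cyclotomic_complex m = monom 1 m - 1"
      using prod_cyclotomic_complex[OF less.prems] D by (simp add: Q mult.commute)
    also have "\<dots> = ?h (monom 1 m - 1)"
      by (simp add: map_poly_of_int_diff map_poly_monom)
    finally have eq: "?h Q * cyclotomic_complex m = ?h (Q * q + r)"
      by (simp add: qr)
    have "?h r = ?h (Q * q + r) - ?h (Q * q)"
      by (simp flip: map_poly_of_int_diff)
    also have "\<dots> = ?h Q * (cyclotomic_complex m - ?h q)"
      by (simp only: eq[symmetric] map_poly_of_int_mult right_diff_distrib)
    finally have hr: "?h r = ?h Q * (cyclotomic_complex m - ?h q)" .
    have "cyclotomic_complex m - ?h q = 0"
    proof (rule ccontr)
      assume *: "cyclotomic_complex m - ?h q \<noteq> 0"
      have Q0: "?h Q \<noteq> 0" using \<open>Q \<noteq> 0\<close> map_poly_of_int_inject[of Q 0] by simp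
      have "degree r = degree Q + degree (cyclotomic_complex m - ?h q)"
        using arg_cong[OF hr, of degree] degree_mult_eq[OF Q0 *]
        by (simp add: degree_map_poly_of_int)
      moreover have "r \<noteq> 0" using hr Q0 * by auto
      ultimately show False using qr(2) by simp
    qed
    then have "?h q = cyclotomic_complex m" by simp
    then show ?case by blast
  qed
  then obtain p :: "int poly" where p: "map_poly of_int p = cyclotomic_complex m" ..
  show ?thesis
    unfolding cyclotomic_def
    by (rule theI[of _ p]) (use p in \<open>auto simp flip: map_poly_of_int_inject\<close>)
qed

definition cyclotomic_over :: "nat \<Rightarrow> 'a :: field poly" where
  "cyclotomic_over m = map_poly of_int (cyclotomic m)"

text \<open>
  Since the roots live in the algebraic closure, the composed multiplication
  is formed as a polynomial over the algebraic closure.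
\<close>
definition composed_mult :: "'a :: field poly \<Rightarrow> 'a poly \<Rightarrow> 'a alg_closure poly"
    (infixl \<open>\<odot>\<close> 70) where
  "f \<odot> g = (\<Prod>\<alpha>\<in>#proots (map_poly to_ac f). \<Prod>\<beta>\<in>#proots (map_poly to_ac g). [:-(\<alpha> * \<beta>), 1:])"

end

theory Submission
  imports Defs
begin

text \<open>
  The roots of \<open>f\<close> form a single Frobenius orbit, and any nonempty Frobenius-stable set of roots
  is all of them. Hence \<open>\<alpha> \<mapsto> \<alpha>\<^sup>r\<close>, which maps roots to roots and commutes with Frobenius, permutes
  the roots, so \<open>f(x\<^sup>m)\<close> is up to a constant the product of all \<open>x\<^sup>m - \<alpha>\<^sup>m\<close> when \<open>m\<close> is a power of
  \<open>r\<close>. Splitting \<open>x\<^sup>m - \<alpha>\<^sup>m\<close> over the roots of unity and cancelling gives the composed product.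
  A root \<open>\<alpha>\<zeta>\<close> of it has Frobenius period \<open>n \<cdot> ord(q)\<close>, because multiplying a period of the product by
  the period of one factor isolates the other factor and the two periods are coprime; this period
  equals the degree, which forces irreducibility.
\<close>

section \<open>Coefficientwise homomorphisms and substitution of monomials\<close>

lemma map_poly_add_hom:
  assumes "h 0 = 0" "\<And>x y. h (x + y) = h x + h y"
  shows "map_poly h (p + q) = map_poly h p + map_poly h q"
  by (intro poly_eqI) (simp add: coeff_map_poly assms)

lemma map_poly_mult_hom:
  fixes h :: "'a :: comm_semiring_0 \<Rightarrow> 'b :: comm_semiring_0"
  assumes "h 0 = 0" "\<And>x y. h (x + y) = h x + h y" "\<And>x y. h (x * y) = h x * h y"
  shows "map_poly h (p * q) = map_poly h p * map_poly h q"
proof (induction p)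
  case (pCons a p)
  then show ?case
    by (simp add: map_poly_pCons map_poly_smult map_poly_add_hom assms)
qed simp

lemma map_poly_prod_hom:
  fixes h :: "'a :: comm_semiring_1 \<Rightarrow> 'b :: comm_semiring_1"
  assumes "h 0 = 0" "h 1 = 1" "\<And>x y. h (x + y) = h x + h y" "\<And>x y. h (x * y) = h x * h y"
  shows "map_poly h (\<Prod>x\<in>A. p x) = (\<Prod>x\<in>A. map_poly h (p x))"
  by (induction A rule: infinite_finite_induct) (simp_all add: map_poly_mult_hom assms)

lemma map_poly_pcompose_hom:
  fixes h :: "'a :: comm_semiring_0 \<Rightarrow> 'b :: comm_semiring_0"
  assumes "h 0 = 0" "\<And>x y. h (x + y) = h x + h y" "\<And>x y. h (x * y) = h x * h y"
  shows "map_poly h (p \<circ>\<^sub>p q) = map_poly h p \<circ>\<^sub>p map_poly h q"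
proof (induction p)
  case (pCons a p)
  then show ?case
    by (simp add: pcompose_pCons map_poly_pCons map_poly_add_hom map_poly_mult_hom assms)
qed simp

lemma poly_map_poly_hom:
  fixes h :: "'a :: comm_semiring_0 \<Rightarrow> 'b :: comm_semiring_0"
  assumes "h 0 = 0" "\<And>x y. h (x + y) = h x + h y" "\<And>x y. h (x * y) = h x * h y"
  shows "poly (map_poly h p) (h x) = h (poly p x)"
  by (induction p) (simp_all add: map_poly_pCons assms)

lemma map_poly_to_ac_mult: "map_poly to_ac (p * q) = map_poly to_ac p * map_poly to_ac q"
  by (rule map_poly_mult_hom) auto

lemma degree_map_poly_to_ac [simp]: "degree (map_poly to_ac p) = degree p"
  by (rule degree_map_poly) auto

lemma map_poly_to_ac_eq_0_iff [simp]: "map_poly to_ac p = 0 \<longleftrightarrow> p = 0"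
  by (rule map_poly_eq_0_iff) auto

lemma map_poly_to_ac_pcompose_monom:
  "map_poly to_ac (p \<circ>\<^sub>p monom 1 m) = map_poly to_ac p \<circ>\<^sub>p monom 1 m"
proof -
  have "map_poly to_ac (p \<circ>\<^sub>p monom 1 m) = map_poly to_ac p \<circ>\<^sub>p map_poly to_ac (monom 1 m)"
    by (rule map_poly_pcompose_hom) auto
  then show ?thesis by (simp add: map_poly_monom)
qed

lemma monom_pcompose_monom:
  "monom (1 :: 'a :: comm_semiring_1) a \<circ>\<^sub>p monom 1 b = monom 1 (a * b)"
  by (induction a) (simp_all add: monom_Suc pcompose_pCons mult_monom pcompose_1)

lemma linear_pcompose_monom:
  "[:-a, 1 :: 'a :: comm_ring_1:] \<circ>\<^sub>p monom 1 m = monom 1 m - [:a:]"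
  by (simp add: pcompose_pCons)

section \<open>The Frobenius map on the algebraic closure\<close>

text \<open>
  The polynomial \<open>(X + 1)\<^sup>q - X\<^sup>q - 1\<close> has degree below \<open>q\<close> but vanishes on the
  whole field, so its coefficients are zero.
\<close>
lemma binomial_card_eq_0:
  assumes "0 < k" "k < CARD('a :: finite_field)"
  shows "of_nat (CARD('a) choose k) = (0 :: 'a)"
proof -
  define q where "q = CARD('a)"
  define P :: "'a poly" where "P = (\<Sum>i\<in>{1..<q}. monom (of_nat (q choose i)) i)"
  have q: "q > 0" using assms by (simp add: q_def)
  have "poly P x = 0" for x
  proof -
    have S: "{..q} = insert 0 (insert q {1..<q})" using q by auto
    have "x + 1 = (x + 1) ^ q" by (simp add: q_def finite_field_power_card_eq_same)
    also have "\<dots> = (\<Sum>i\<le>q. of_nat (q choose i) * x ^ i)"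
      by (subst binomial_ring) simp
    also have "\<dots> = 1 + x ^ q + poly P x"
      unfolding S using q by (subst sum.insert, simp, simp, subst sum.insert)
        (auto simp: P_def poly_sum poly_monom)
    also have "x ^ q = x" by (simp add: q_def finite_field_power_card_eq_same)
    finally show ?thesis by simp
  qed
  then have roots: "{x. poly P x = 0} = UNIV" by auto
  have "degree P \<le> q - 1"
    unfolding P_def by (rule degree_sum_le) (auto intro: order.trans[OF degree_monom_le])
  then have "P = 0"
    using card_poly_roots_bound[of P] q unfolding roots q_def[symmetric]
    by (cases "P = 0") auto
  then have "coeff P k = 0" by simp
  moreover have "coeff P k = of_nat (q choose k)"
    using assms by (simp add: P_def coeff_sum q_def)
  ultimately show ?thesis by (simp add: q_def)
qed

text \<open>The inner binomial coefficients vanish already in the base field, and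
  \<open>to_ac\<close> carries this to the closure.\<close>

lemma frobenius_add:
  fixes x y :: "'a :: finite_field alg_closure"
  shows "(x + y) ^ CARD('a) = x ^ CARD('a) + y ^ CARD('a)"
proof -
  define q where "q = CARD('a)"
  have q: "q > 0" by (simp add: q_def)
  have S: "{..q} = insert 0 (insert q {1..<q})" using q by auto
  have 0: "of_nat (q choose i) = (0 :: 'a alg_closure)" if "i \<in> {1..<q}" for i
    using that binomial_card_eq_0[of i, where 'a = 'a]
    by (metis to_ac_0 to_ac_of_nat atLeastLessThan_iff q_def less_eq_Suc_le One_nat_def)
  have "(x + y) ^ q = (\<Sum>i\<le>q. of_nat (q choose i) * x ^ i * y ^ (q - i))"
    by (rule binomial_ring)
  also have "\<dots> = y ^ q + x ^ q"
    unfolding S using q by (subst sum.insert, simp, simp, subst sum.insert) (auto simp: 0)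
  finally show ?thesis by (simp add: q_def add.commute)
qed

lemma frobenius_minus:
  fixes x :: "'a :: finite_field alg_closure"
  shows "(- x) ^ CARD('a) = - (x ^ CARD('a))"
proof -
  have "x ^ CARD('a) + (- x) ^ CARD('a) = 0"
    using frobenius_add[of x "-x"] by (simp add: power_0_left)
  then show ?thesis by (simp only: minus_unique)
qed

text \<open>By additivity \<open>(x - y) ^ CARD('a) = 0\<close>, and a field has no nonzero
  nilpotents.\<close>

lemma frobenius_inject:
  fixes x y :: "'a :: finite_field alg_closure"
  shows "x ^ CARD('a) = y ^ CARD('a) \<longleftrightarrow> x = y"
proof
  assume "x ^ CARD('a) = y ^ CARD('a)"
  then have "(x - y) ^ CARD('a) = 0"
    using frobenius_add[of x "-y"] by (simp add: frobenius_minus)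
  then show "x = y" by simp
qed simp

lemma frobenius_iter_inject:
  fixes x y :: "'a :: finite_field alg_closure"
  shows "x ^ (CARD('a) ^ i) = y ^ (CARD('a) ^ i) \<longleftrightarrow> x = y"
proof (induction i)
  case (Suc i)
  then show ?case
    by (simp only: power_Suc2 power_mult frobenius_inject)
qed simp

text \<open>Injectivity strips \<open>i\<close> iterations from both sides, so any coincidence
  within an orbit becomes a return to \<open>x\<close> itself.\<close>

lemma frobenius_cancel:
  fixes x :: "'a :: finite_field alg_closure"
  assumes "x ^ (CARD('a) ^ i) = x ^ (CARD('a) ^ j)" "i \<le> j"
  shows "x ^ (CARD('a) ^ (j - i)) = x"
proof -
  have "(x ^ (CARD('a) ^ (j - i))) ^ (CARD('a) ^ i) = x ^ (CARD('a) ^ i)"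
    using assms by (simp flip: power_mult power_add)
  then show ?thesis by (simp only: frobenius_iter_inject)
qed

lemma inj_on_frobenius_orbit:
  fixes x :: "'a :: finite_field alg_closure"
  assumes "\<And>d. 0 < d \<Longrightarrow> x ^ (CARD('a) ^ d) = x \<Longrightarrow> m \<le> d"
  shows "inj_on (\<lambda>i. x ^ (CARD('a) ^ i)) {..<m}"
proof (rule linorder_inj_onI)
  fix i j assume "i < j" "i \<in> {..<m}" "j \<in> {..<m}"
  then show "x ^ (CARD('a) ^ i) \<noteq> x ^ (CARD('a) ^ j)"
    using frobenius_cancel[of x i j] assms[of "j - i"] by force
qed auto

lemma iterated_power_period_mult:
  fixes x :: "'a :: monoid_mult"
  assumes "x ^ (q ^ d) = x"
  shows "x ^ (q ^ (d * e)) = x"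
proof (induction e)
  case (Suc e)
  have "x ^ (q ^ (d * Suc e)) = (x ^ (q ^ d)) ^ (q ^ (d * e))"
    by (simp add: power_add flip: power_mult)
  with Suc assms show ?case by simp
qed simp

lemma to_ac_frobenius: "to_ac (c :: 'a :: finite_field) ^ CARD('a) = to_ac c"
  by (metis to_ac_power finite_field_power_card_eq_same)

text \<open>The base field supplies q = \<open>CARD('a)\<close> roots of X^q - X, as many as its
  degree allows. This is the criterion by which coefficients descend to the base field.\<close>

lemma frobenius_fixed_iff:
  fixes z :: "'a :: finite_field alg_closure"
  shows "z ^ CARD('a) = z \<longleftrightarrow> z \<in> range to_ac"
proof
  assume "z \<in> range to_ac"
  then show "z ^ CARD('a) = z"
    by (auto simp: to_ac_frobenius)
next
  assume z: "z ^ CARD('a) = z"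
  define P :: "'a alg_closure poly" where "P = monom 1 CARD('a) - monom 1 1"
  \<comment> \<open>A field has two distinct elements, so the two monomials of \<open>P\<close> do
    not cancel.\<close>
  have "1 \<noteq> CARD('a)" using card_mono[of "UNIV :: 'a set" "{0, 1}"] by auto
  then have "coeff P CARD('a) = 1" by (simp add: P_def)
  then have "P \<noteq> 0" by auto
  have "degree P \<le> CARD('a)"
    unfolding P_def by (intro degree_diff_le order.trans[OF degree_monom_le]) (auto simp: Suc_le_eq)
  then have "card {x. poly P x = 0} \<le> CARD('a)"
    using card_poly_roots_bound[OF \<open>P \<noteq> 0\<close>] by simp
  moreover have "card (range to_ac :: 'a alg_closure set) = CARD('a)"
    by (rule card_image) (rule inj_to_ac)
  moreover have "range to_ac \<subseteq> {x. poly P x = 0}"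
    by (auto simp: P_def poly_monom to_ac_frobenius)
  ultimately have "range to_ac = {x. poly P x = 0}"
    using poly_roots_finite[OF \<open>P \<noteq> 0\<close>] by (intro card_seteq) auto
  moreover have "poly P z = 0" using z by (simp add: P_def poly_monom)
  ultimately show "z \<in> range to_ac" by simp
qed

lemma map_poly_frobenius_to_ac:
  "map_poly (\<lambda>x. x ^ CARD('a)) (map_poly to_ac p) = map_poly to_ac (p :: 'a :: finite_field poly)"
  by (intro poly_eqI)
     (simp add: coeff_map_poly to_ac_frobenius)

lemma poly_frobenius:
  fixes p :: "'a :: finite_field poly"
  shows "poly (map_poly to_ac p) (z ^ CARD('a)) = poly (map_poly to_ac p) z ^ CARD('a)"
  using poly_map_poly_hom[of "\<lambda>x. x ^ CARD('a)" "map_poly to_ac p" z]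
  by (simp add: map_poly_frobenius_to_ac frobenius_add power_mult_distrib)

lemma root_frobenius_iter:
  fixes p :: "'a :: finite_field poly"
  assumes "poly (map_poly to_ac p) z = 0"
  shows "poly (map_poly to_ac p) (z ^ (CARD('a) ^ i)) = 0"
proof (induction i)
  case (Suc i)
  then show ?case
    by (simp only: power_Suc2 power_mult poly_frobenius) simp
qed (use assms in simp)

section \<open>Irreducible polynomials and Frobenius orbits\<close>

text \<open>By division with remainder, a nonzero polynomial of least degree vanishing at
  \<open>z\<close> divides every polynomial vanishing at \<open>z\<close>. Being a nonunit divisor
  of the irreducible \<open>f\<close>, it is associated to \<open>f\<close>.\<close>

lemma irreducible_dvd_if_common_root:
  fixes f g :: "'a :: field poly"
  assumes "irreducible f" "poly (map_poly to_ac f) z = 0" "poly (map_poly to_ac g) z = 0"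
  shows "f dvd g"
proof -
  define V where "V = (\<lambda>p::'a poly. p \<noteq> 0 \<and> poly (map_poly to_ac p) z = 0)"
  have "V f" using assms by (auto simp: V_def irreducible_def)
  obtain p where p: "V p" and min: "\<And>s. V s \<Longrightarrow> degree p \<le> degree s"
    using exists_least_iff[of "\<lambda>k. \<exists>p. V p \<and> degree p = k"] \<open>V f\<close>
    by (metis linorder_not_le)
  have dvd: "p dvd s" if "poly (map_poly to_ac s) z = 0" for s
  proof (rule ccontr)
    assume "\<not> p dvd s"
    then have nz: "s mod p \<noteq> 0" by (simp add: mod_eq_0_iff_dvd)
    have "map_poly to_ac s = map_poly to_ac (p * (s div p) + s mod p)" by simp
    also have "\<dots> = map_poly to_ac p * map_poly to_ac (s div p) + map_poly to_ac (s mod p)"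
      by (simp only: map_poly_add_hom[of to_ac, OF to_ac_0 to_ac_add] map_poly_to_ac_mult)
    finally have "poly (map_poly to_ac (s mod p)) z = 0"
      using that p by (simp add: V_def)
    then have "degree p \<le> degree (s mod p)" using nz by (intro min) (simp add: V_def)
    then show False using degree_mod_less[of p s] nz p by (simp add: V_def)
  qed
  from dvd[OF assms(2)] obtain u where u: "f = p * u" by (elim dvdE)
  have "\<not> is_unit p"
  proof
    assume "is_unit p"
    then obtain c where "p = [:c:]" "c \<noteq> 0" using p by (auto simp: is_unit_poly_iff V_def)
    then show False using p by (simp add: V_def map_poly_pCons)
  qed
  then have "is_unit u" using assms(1) u by (auto simp: irreducible_def)
  then show ?thesis
    using dvd[OF assms(3)] u by (simp add: mult_unit_dvd_iff)
qed

text \<open>Frobenius permutes the finite set \<open>S\<close>, so the product of x - s over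
  \<open>S\<close> descends to the base field. It shares a root with \<open>f\<close>, hence is
  divisible by \<open>f\<close>, and its degree is at most that of \<open>f\<close>; so the two
  agree up to a constant.\<close>

lemma irreducible_eq_prod_frobenius_stable:
  fixes f :: "'a :: finite_field poly"
  assumes "irreducible f" "S \<noteq> {}" "S \<subseteq> {x. poly (map_poly to_ac f) x = 0}"
    and stable: "(\<lambda>x. x ^ CARD('a)) ` S \<subseteq> S"
  obtains c where "c \<noteq> 0" "map_poly to_ac f = smult c (\<Prod>x\<in>S. [:-x, 1:])"
proof -
  let ?h = "\<lambda>x :: 'a alg_closure. x ^ CARD('a)"
  let ?P = "\<Prod>x\<in>S. [:-x, 1:]"
  have f0: "f \<noteq> 0" using assms(1) by (auto simp: irreducible_def)
  have fin: "finite S"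
    using finite_subset[OF assms(3) poly_roots_finite] f0 by simp
  have inj: "inj_on ?h S" by (rule inj_onI) (simp add: frobenius_inject)
  have im: "?h ` S = S"
    by (rule endo_inj_surj[OF fin stable inj])
  have "map_poly ?h ?P = (\<Prod>x\<in>S. map_poly ?h [:-x, 1:])"
    by (rule map_poly_prod_hom) (simp_all add: frobenius_add power_mult_distrib)
  also have "\<dots> = (\<Prod>x\<in>S. [:-(?h x), 1:])"
    by (simp add: map_poly_pCons frobenius_minus)
  also have "\<dots> = (\<Prod>x\<in>?h ` S. [:-x, 1:])"
    by (simp add: prod.reindex[OF inj])
  finally have invariant: "map_poly ?h ?P = ?P" by (simp add: im)
  \<comment> \<open>Frobenius-fixed coefficients lie in the base field, so \<open>of_ac\<close>
    pulls \<open>?P\<close> back faithfully.\<close>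
  have "coeff ?P i \<in> range to_ac" for i
    using arg_cong[OF invariant, of "\<lambda>p. coeff p i"] by (simp add: coeff_map_poly flip: frobenius_fixed_iff)
  then have g: "map_poly to_ac (map_poly of_ac ?P) = ?P" (is "map_poly to_ac ?g = _")
    by (intro poly_eqI) (simp add: coeff_map_poly to_ac_of_ac)
  obtain z where z: "z \<in> S" using assms(2) by auto
  have "poly ?P z = 0" using z fin by (simp add: poly_prod)
  then have "f dvd ?g"
    using irreducible_dvd_if_common_root[OF assms(1), of z ?g] z assms(3) g by auto
  then obtain u where u: "?g = f * u" by (elim dvdE)
  have degP: "degree ?P = card S"
    by (subst degree_prod_eq_sum_degree) auto
  have P0: "?P \<noteq> 0" using fin by simp
  have "?g \<noteq> 0" using g P0 by auto
  then have "u \<noteq> 0" using u by auto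
  \<comment> \<open>\<open>S\<close> consists of distinct roots of \<open>f\<close>; with
    \<open>f dvd ?g\<close> this forces the cofactor \<open>u\<close> to be constant.\<close>
  have "card S \<le> degree f"
    using card_mono[OF poly_roots_finite assms(3)] card_poly_roots_bound[of "map_poly to_ac f"] f0
    by simp
  moreover have "degree f + degree u = card S"
    using degree_mult_eq[OF f0 \<open>u \<noteq> 0\<close>] arg_cong[OF g, of degree] degP u by simp
  ultimately have "degree u = 0" by simp
  then obtain b where b: "u = [:b:]" by (rule degree_eq_zeroE)
  then have "b \<noteq> 0" using \<open>u \<noteq> 0\<close> by auto
  have "?P = smult (to_ac b) (map_poly to_ac f)"
    using g unfolding u b by (simp add: map_poly_smult)
  then have "map_poly to_ac f = smult (inverse (to_ac b)) ?P"
    using \<open>b \<noteq> 0\<close> by simp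
  then show ?thesis using that[of "inverse (to_ac b)"] \<open>b \<noteq> 0\<close> by simp
qed

lemma irreducible_frobenius_stable_roots:
  fixes f :: "'a :: finite_field poly"
  assumes "irreducible f" "S \<noteq> {}" "S \<subseteq> {x. poly (map_poly to_ac f) x = 0}"
    "(\<lambda>x. x ^ CARD('a)) ` S \<subseteq> S"
  shows "S = {x. poly (map_poly to_ac f) x = 0}" "card S = degree f"
proof -
  obtain c where c: "c \<noteq> 0" "map_poly to_ac f = smult c (\<Prod>x\<in>S. [:-x, 1:])"
    using irreducible_eq_prod_frobenius_stable[OF assms] .
  have "f \<noteq> 0" using assms(1) by (auto simp: irreducible_def)
  then have fin: "finite S"
    using finite_subset[OF assms(3) poly_roots_finite] by simp
  then show "S = {x. poly (map_poly to_ac f) x = 0}"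
    using c by (auto simp: poly_prod)
  have "degree (map_poly to_ac f) = card S"
    unfolding c(2) using c(1) by (subst degree_smult_eq, subst degree_prod_eq_sum_degree) auto
  then show "card S = degree f" by simp
qed

lemma irreducible_imp_root:
  fixes f :: "'a :: field poly"
  assumes "irreducible f"
  obtains z where "poly (map_poly to_ac f) z = 0"
proof -
  have "degree f \<noteq> 0" using assms by (auto simp: irreducible_def is_unit_iff_degree)
  then show ?thesis
    using alg_closed_imp_poly_has_root[of "map_poly to_ac f"] that by auto
qed

text \<open>The full root set is Frobenius-stable. Since the product runs over a set, this also
  shows that the roots are simple.\<close>

lemma irreducible_eq_prod_roots:
  fixes f :: "'a :: finite_field poly"
  assumes "irreducible f"
  obtains c where "c \<noteq> 0"
    "map_poly to_ac f = smult c (\<Prod>x | poly (map_poly to_ac f) x = 0. [:-x, 1:])"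
proof -
  obtain z where z: "poly (map_poly to_ac f) z = 0" using irreducible_imp_root[OF assms] .
  show ?thesis
    by (rule irreducible_eq_prod_frobenius_stable[OF assms _ subset_refl])
       (use z that in \<open>auto simp: poly_frobenius\<close>)
qed

text \<open>The orbit of \<open>z\<close> is a nonempty stable set of roots, so it has exactly
  \<open>degree f\<close> elements; on the other hand its size is the least period of
  \<open>z\<close>.\<close>

lemma irreducible_root_frobenius_period:
  fixes f :: "'a :: finite_field poly"
  assumes "irreducible f" "poly (map_poly to_ac f) z = 0"
  shows "z ^ (CARD('a) ^ d) = z \<longleftrightarrow> degree f dvd d"
proof -
  define \<phi> where "\<phi> = (\<lambda>i. z ^ (CARD('a) ^ i))"
  have f0: "f \<noteq> 0" using assms by (auto simp: irreducible_def)
  have sub: "range \<phi> \<subseteq> {x. poly (map_poly to_ac f) x = 0}"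
    using root_frobenius_iter[OF assms(2)] by (auto simp: \<phi>_def)
  have card: "card (range \<phi>) = degree f"
  proof (rule irreducible_frobenius_stable_roots[OF assms(1) _ sub])
    have "\<phi> i ^ CARD('a) = \<phi> (Suc i)" for i
      by (simp add: \<phi>_def mult.commute flip: power_mult)
    then show "(\<lambda>x. x ^ CARD('a)) ` range \<phi> \<subseteq> range \<phi>" by auto
  qed auto
  have "finite (range \<phi>)"
    using finite_subset[OF sub poly_roots_finite] f0 by simp
  \<comment> \<open>In a finite orbit two iterates coincide, and cancelling gives a positive period,
    so the least period \<open>m\<close> exists.\<close>
  then have "\<not> inj \<phi>" using finite_imageD by blast
  then obtain i j where "i < j" "\<phi> i = \<phi> j"
    unfolding inj_def by (metis linorder_neqE_nat)
  then have ex: "\<exists>m. 0 < m \<and> \<phi> m = z"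
    using frobenius_cancel[of z i j] by (intro exI[of _ "j - i"]) (auto simp: \<phi>_def)
  define m where "m = (LEAST m. 0 < m \<and> \<phi> m = z)"
  have m: "0 < m" "\<phi> m = z" using LeastI_ex[OF ex] by (auto simp: m_def)
  have min: "m \<le> e" if "0 < e" "\<phi> e = z" for e
    unfolding m_def using that by (intro Least_le) auto
  \<comment> \<open>The first \<open>m\<close> iterates exhaust the orbit; minimality of
    \<open>m\<close> makes them distinct.\<close>
  have "\<phi> i = \<phi> (i mod m)" for i
  proof -
    have "\<phi> i = z ^ (CARD('a) ^ (m * (i div m)) * CARD('a) ^ (i mod m))"
      by (simp add: \<phi>_def flip: power_add)
    also have "\<dots> = \<phi> (i mod m)"
      using iterated_power_period_mult[of z "CARD('a)" m "i div m"] m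
      by (simp add: \<phi>_def power_mult)
    finally show ?thesis .
  qed
  note mod_eq = this
  have "range \<phi> = \<phi> ` {..<m}"
  proof
    show "range \<phi> \<subseteq> \<phi> ` {..<m}"
      using mod_eq m(1) by (metis image_subsetI imageI lessThan_iff mod_less_divisor)
  qed auto
  moreover have "inj_on \<phi> {..<m}"
    unfolding \<phi>_def by (rule inj_on_frobenius_orbit) (use min in \<open>auto simp: \<phi>_def\<close>)
  ultimately have "m = degree f" using card by (simp add: card_image)
  moreover have "\<phi> d = z \<longleftrightarrow> m dvd d"
  proof
    assume "\<phi> d = z"
    then have "\<phi> (d mod m) = z" using mod_eq by simp
    then show "m dvd d" using min[of "d mod m"] m(1)
      by (metis dvd_eq_mod_eq_0 mod_less_divisor not_gr_zero linorder_not_le)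
  next
    assume "m dvd d"
    then show "\<phi> d = z" using mod_eq[of d] by (simp add: \<phi>_def)
  qed
  ultimately show ?thesis by (simp add: \<phi>_def)
qed

text \<open>Any factor vanishing at \<open>z\<close> also vanishes at the first
  \<open>degree p\<close> Frobenius iterates of \<open>z\<close>, which are distinct. It therefore
  has full degree, leaving a constant cofactor.\<close>

lemma irreducible_if_frobenius_period:
  fixes p :: "'a :: finite_field poly"
  assumes "degree p > 0" "poly (map_poly to_ac p) z = 0"
    and period: "\<And>d. 0 < d \<Longrightarrow> z ^ (CARD('a) ^ d) = z \<Longrightarrow> degree p \<le> d"
  shows "irreducible p"
proof -
  have p0: "p \<noteq> 0" using assms(1) by auto
  have big: "degree p \<le> degree a" if "poly (map_poly to_ac a) z = 0" "a \<noteq> 0" for a :: "'a poly"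
  proof -
    have "(\<lambda>i. z ^ (CARD('a) ^ i)) ` {..<degree p} \<subseteq> {x. poly (map_poly to_ac a) x = 0}"
      using root_frobenius_iter[OF that(1)] by auto
    from card_mono[OF poly_roots_finite this] show ?thesis
      using that(2) card_poly_roots_bound[of "map_poly to_ac a"]
      by (simp add: card_image[OF inj_on_frobenius_orbit[OF period]])
  qed
  show ?thesis
  proof (rule irreducibleI)
    show "p \<noteq> 0" by (fact p0)
    show "\<not> is_unit p" using assms(1) p0 by (simp add: is_unit_iff_degree)
    fix a b assume p: "p = a * b"
    then have nz: "a \<noteq> 0" "b \<noteq> 0" using p0 by auto
    have deg: "degree p = degree a + degree b" using nz by (simp add: p degree_mult_eq)
    have "poly (map_poly to_ac a) z = 0 \<or> poly (map_poly to_ac b) z = 0"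
      using assms(2) by (simp add: p map_poly_to_ac_mult)
    then have "degree b = 0 \<or> degree a = 0" using big[of a] big[of b] nz deg by auto
    then show "is_unit a \<or> is_unit b" using nz by (auto simp: is_unit_iff_degree)
  qed
qed

section \<open>Cyclotomic polynomials of prime power order\<close>

text \<open>The divisors of r^(k+1) are r^(k+1) itself and the divisors of r^k, so the
  factorizations of X^m - 1 for these two exponents differ by one cyclotomic factor. The complex
  identity descends to the integers by injectivity.\<close>

lemma cyclotomic_prime_power:
  assumes "prime r"
  shows "cyclotomic (r ^ Suc k) * (monom 1 (r ^ k) - 1) = monom 1 (r ^ Suc k) - 1"
proof -
  have r: "r > 1" using assms prime_gt_1_nat by blast
  have "{d. d dvd r ^ Suc k} = insert (r ^ Suc k) {d. d dvd r ^ k}"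
    using assms by (auto simp: divides_primepow_nat le_Suc_eq simp del: power_Suc)
  moreover have "\<not> r ^ Suc k dvd r ^ k"
    using r by (auto dest: dvd_imp_le)
  ultimately have "(\<Prod>d | d dvd r ^ Suc k. cyclotomic_complex d) =
      cyclotomic_complex (r ^ Suc k) * (\<Prod>d | d dvd r ^ k. cyclotomic_complex d)"
    using r by (simp del: power_Suc)
  then have "cyclotomic_complex (r ^ Suc k) * (monom 1 (r ^ k) - 1) = monom 1 (r ^ Suc k) - 1"
    using r by (simp add: prod_cyclotomic_complex del: power_Suc)
  moreover have "map_poly (of_int :: int \<Rightarrow> complex) (monom 1 m - 1) = monom 1 m - 1" for m
    by (simp add: map_poly_of_int_diff map_poly_monom)
  ultimately show ?thesis
    using r by (simp add: map_poly_of_int_mult of_int_cyclotomic del: power_Suc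
        flip: map_poly_of_int_inject)
qed

lemma cyclotomic_over_prime_power:
  assumes "prime r"
  shows "cyclotomic_over (r ^ Suc k) * (monom 1 (r ^ k) - 1)
    = (monom 1 (r ^ Suc k) - 1 :: 'a :: field poly)"
proof -
  have *: "map_poly of_int (monom 1 m - 1) = (monom 1 m - 1 :: 'a poly)" for m
    by (rule poly_eqI) (simp add: coeff_map_poly)
  show ?thesis
    unfolding cyclotomic_over_def *[symmetric] cyclotomic_prime_power[OF assms, symmetric]
    by (rule map_poly_mult_hom[symmetric]) auto
qed

lemma map_poly_to_ac_cyclotomic_over:
  "map_poly to_ac (cyclotomic_over m :: 'a :: field poly) = cyclotomic_over m"
  by (simp add: cyclotomic_over_def map_poly_map_poly o_def)

lemma degree_monom_minus_1:
  assumes "m > 0"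
  shows "degree (monom 1 m - 1 :: 'a :: comm_ring_1 poly) = m"
    and "lead_coeff (monom 1 m - 1 :: 'a :: comm_ring_1 poly) = 1"
proof -
  show "degree (monom 1 m - 1 :: 'a poly) = m"
    using assms degree_add_eq_left[of "-1" "monom 1 m :: 'a poly"] by (simp add: degree_monom_eq)
  then show "lead_coeff (monom 1 m - 1 :: 'a poly) = 1"
    using assms by simp
qed

text \<open>Substituting x/a multiplies every root by \<open>a\<close>; the power of
  \<open>a\<close> in front makes the result monic again. Multisets keep track of
  multiplicities.\<close>

lemma prod_mset_scaled_roots:
  fixes a :: "'a :: field"
  assumes "a \<noteq> 0"
  shows "(\<Prod>b\<in>#B. [:-(a * b), 1:]) = smult (a ^ size B) ((\<Prod>b\<in>#B. [:-b, 1:]) \<circ>\<^sub>p [:0, inverse a:])"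
proof (induction B)
  case (add b B)
  have "[:-(a * b), 1:] = smult a ([:-b, 1:] \<circ>\<^sub>p [:0, inverse a:])"
    using assms by (simp add: pcompose_pCons)
  then have "(\<Prod>b\<in>#add_mset b B. [:-(a * b), 1:]) = smult a ([:-b, 1:] \<circ>\<^sub>p [:0, inverse a:])
      * smult (a ^ size B) ((\<Prod>b\<in>#B. [:-b, 1:]) \<circ>\<^sub>p [:0, inverse a:])"
    by (simp only: image_mset_add_mset prod_mset.add_mset add)
  moreover have "(\<Prod>b\<in>#add_mset b B. [:-b, 1:]) = [:-b, 1:] * (\<Prod>b\<in>#B. [:-b, 1:])"
    by (simp only: image_mset_add_mset prod_mset.add_mset)
  ultimately show ?case
    by (simp only: pcompose_mult mult_smult_left mult_smult_right smult_smult size_add_mset power_Suc mult.commute)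
qed (simp add: pcompose_1)

text \<open>Scaling the roots of X^m - 1 gives a^m ((X/a)^m - 1). This turns products over roots of
  unity into binomials.\<close>

lemma prod_mset_scaled_roots_of_unity:
  fixes a :: "'a :: alg_closed_field"
  assumes "a \<noteq> 0" "m > 0"
  shows "(\<Prod>b\<in>#proots (monom 1 m - 1). [:-(a * b), 1:]) = monom 1 m - [:a ^ m:]"
proof -
  let ?p = "monom 1 m - 1 :: 'a poly"
  have "?p \<noteq> 0" using degree_monom_minus_1(1)[OF assms(2), where ?'a = 'a] assms(2) by auto
  then obtain A where A: "size A = m" "?p = (\<Prod>x\<in>#A. [:-x, 1:])"
    using alg_closed_imp_factorization[of ?p] degree_monom_minus_1[OF assms(2), where ?'a = 'a] by auto
  have "proots (\<Prod>x\<in>#A. [:-x, 1:]) = A"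
  proof -
    have "proots (\<Prod>p\<in>#image_mset (\<lambda>x. [:-x, 1:]) A. p) = (\<Sum>p\<in>#image_mset (\<lambda>x. [:-x, 1:]) A. proots p)"
      by (rule proots_prod_mset) auto
    then show ?thesis by (simp add: image_mset.compositionality o_def)
  qed
  then have "proots ?p = A" by (simp only: A(2))
  then have "(\<Prod>b\<in>#proots ?p. [:-(a * b), 1:]) = smult (a ^ m) (?p \<circ>\<^sub>p [:0, inverse a:])"
    using A prod_mset_scaled_roots[OF assms(1), of A] by simp
  also have "\<dots> = monom 1 m - [:a ^ m:]"
  proof -
    have "monom 1 m \<circ>\<^sub>p [:0, inverse a:] = monom (inverse a ^ m) m"
      by (induction m) (simp_all add: monom_0 monom_Suc pcompose_pCons pcompose_1 smult_monom flip: one_pCons)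
    then show ?thesis
      using assms(1) by (simp add: pcompose_diff pcompose_1 smult_diff_right smult_monom power_inverse one_pCons)
  qed
  finally show ?thesis .
qed

lemma power_gcd_eq_1:
  fixes x :: "'a :: field"
  assumes "x ^ a = 1" "x ^ b = 1"
  shows "x ^ gcd a b = 1"
proof (cases "a = 0")
  case False
  \<comment> \<open>Bezout over the naturals keeps all exponents nonnegative; it asks for a nonzero
    \<open>a\<close>, hence the case split.\<close>
  then obtain u v where "a * u = b * v + gcd a b" using bezout_nat by blast
  then have "x ^ (a * u) = x ^ (b * v) * x ^ gcd a b" by (simp add: power_add)
  then show ?thesis using assms by (simp add: power_mult)
qed (use assms in simp)

text \<open>
  Since \<open>r\<close> is invertible, \<open>X ^ r ^ Suc k - 1\<close> has simple roots, so a root of the cyclotomic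
  factor is not a root of the cofactor \<open>X ^ r ^ k - 1\<close>.
\<close>
lemma root_cyclotomic_over_prime_power:
  fixes z :: "'a :: field"
  assumes r: "prime r" "of_nat r \<noteq> (0 :: 'a)" and z: "poly (cyclotomic_over (r ^ Suc k)) z = 0"
  shows "z ^ e = 1 \<longleftrightarrow> r ^ Suc k dvd e"
proof -
  define P where "P = (cyclotomic_over (r ^ Suc k) :: 'a poly)"
  have PQ: "P * (monom 1 (r ^ k) - 1) = monom 1 (r ^ Suc k) - 1"
    unfolding P_def by (rule cyclotomic_over_prime_power[OF r(1)])
  have z1: "z ^ r ^ Suc k = 1"
    using arg_cong[OF PQ, of "\<lambda>p. poly p z"] z by (simp add: poly_monom P_def)
  then have z0: "z \<noteq> 0" using r(1) by (auto simp: power_0_left prime_gt_0_nat split: if_splits)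
  have zk: "z ^ r ^ k \<noteq> 1"
  proof
    assume "z ^ r ^ k = 1"
    then have "poly (pderiv (P * (monom 1 (r ^ k) - 1))) z = 0"
      using z by (simp add: pderiv_mult poly_monom P_def)
    then have "of_nat (r ^ Suc k) * z ^ (r ^ Suc k - 1) = 0"
      unfolding PQ by (simp add: pderiv_diff pderiv_monom poly_monom del: power_Suc)
    then show False using r z0 by simp
  qed
  show ?thesis
  proof
    assume e: "z ^ e = 1"
    \<comment> \<open>The gcd is a power of \<open>r\<close> that still kills \<open>z\<close>; an
      exponent \<open>j\<close> of at most \<open>k\<close> would contradict
      \<open>zk\<close>.\<close>
    obtain j where j: "j \<le> Suc k" "gcd (r ^ Suc k) e = r ^ j"
      using divides_primepow_nat[OF r(1), of "gcd (r ^ Suc k) e" "Suc k"] by auto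
    have zj: "z ^ r ^ j = 1" using power_gcd_eq_1[OF z1 e] j by simp
    have "\<not> j \<le> k"
    proof
      assume "j \<le> k"
      then have "r ^ k = r ^ j * r ^ (k - j)" by (simp flip: power_add)
      then show False using zk zj by (simp add: power_mult)
    qed
    with j have "gcd (r ^ Suc k) e = r ^ Suc k" by (simp add: le_Suc_eq)
    then show "r ^ Suc k dvd e" by (metis gcd_dvd2)
  next
    assume "r ^ Suc k dvd e"
    then show "z ^ e = 1" using z1 by (auto simp: dvd_def power_mult simp del: power_Suc)
  qed
qed

text \<open>Cancelling one factor \<open>z\<close> turns the left side into
  \<open>m dvd q ^ d - 1\<close>, that is, q^d = 1 modulo \<open>m\<close>.\<close>

lemma root_of_unity_frobenius_period:
  fixes z :: "'a :: field"
  assumes "\<And>e. z ^ e = 1 \<longleftrightarrow> m dvd e" "m > 0" "q > 0"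
  shows "z ^ (q ^ d) = z \<longleftrightarrow> ord m q dvd d"
proof -
  have "z ^ m = 1" by (simp add: assms(1))
  then have z0: "z \<noteq> 0" using assms(2) by (auto simp: power_0_left)
  have qd: "q ^ d = Suc (q ^ d - 1)" using assms(3) by simp
  have "z ^ (q ^ d) = z \<longleftrightarrow> z ^ (q ^ d - 1) = 1"
    by (subst qd) (simp add: z0)
  also have "\<dots> \<longleftrightarrow> [q ^ d = 1] (mod m)"
    using assms(1,3) by (simp add: cong_altdef_nat)
  finally show ?thesis by (simp only: ord_divides)
qed

section \<open>Composed products with cyclotomic polynomials\<close>

lemma irreducible_composed_product:
  fixes f G :: "'a :: finite_field poly"
  assumes f: "irreducible f" "poly (map_poly to_ac f) a = 0" "a \<noteq> 0"
    and z: "\<And>e. z ^ e = 1 \<longleftrightarrow> m dvd e" "m > 0" "coprime m CARD('a)"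
    and cop: "coprime (degree f) (ord m CARD('a))"
    and G: "poly (map_poly to_ac G) (a * z) = 0" "degree G = degree f * ord m CARD('a)"
  shows "irreducible G"
proof (rule irreducible_if_frobenius_period[of _ "a * z"])
  have pa: "a ^ (CARD('a) ^ d) = a \<longleftrightarrow> degree f dvd d" for d
    by (rule irreducible_root_frobenius_period[OF f(1,2)])
  have pz: "z ^ (CARD('a) ^ d) = z \<longleftrightarrow> ord m CARD('a) dvd d" for d
    by (rule root_of_unity_frobenius_period[OF z(1,2)]) simp
  have "z ^ m = 1" by (simp add: z(1))
  then have z0: "z \<noteq> 0" using z(2) by (auto simp: power_0_left)
  have "degree f \<noteq> 0" using f(1) by (auto simp: irreducible_def is_unit_iff_degree)
  moreover have "ord m CARD('a) \<noteq> 0" using z(3) by (simp add: ord_eq_0)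
  ultimately show "degree G > 0" by (simp add: G(2))
  show "poly (map_poly to_ac G) (a * z) = 0" by (fact G(1))
  fix d :: nat assume d: "0 < d" and az: "(a * z) ^ (CARD('a) ^ d) = a * z"
  have az': "a ^ (CARD('a) ^ (d * e)) * z ^ (CARD('a) ^ (d * e)) = a * z" for e
    using iterated_power_period_mult[OF az] by (simp add: power_mult_distrib)
  \<comment> \<open>This exponent is a period of both \<open>a * z\<close> and \<open>z\<close>,
    hence of \<open>a\<close>, and coprimality removes the extra factor. Afterwards the roles of
    \<open>a\<close> and \<open>z\<close> are exchanged.\<close>
  have "z ^ (CARD('a) ^ (d * ord m CARD('a))) = z" by (simp add: pz)
  then have "a ^ (CARD('a) ^ (d * ord m CARD('a))) = a"
    using az'[of "ord m CARD('a)"] z0 by simp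
  then have 1: "degree f dvd d" using cop by (simp add: pa coprime_dvd_mult_left_iff)
  have "a ^ (CARD('a) ^ (d * degree f)) = a" by (simp add: pa)
  then have "z ^ (CARD('a) ^ (d * degree f)) = z"
    using az'[of "degree f"] f(3) by simp
  then have 2: "ord m CARD('a) dvd d"
    using cop by (simp add: pz coprime_dvd_mult_left_iff coprime_commute)
  show "degree G \<le> d"
    using divides_mult[OF 1 2 cop] d by (simp add: G(2) dvd_imp_le)
qed

text \<open>The divisibility sends roots to roots. The image is nonempty and Frobenius-stable
  because powers commute, so it is all of \<open>R\<close>; a surjection of a finite set onto itself
  is injective.\<close>

lemma bij_betw_power_roots:
  fixes f :: "'a :: finite_field poly"
  assumes f: "irreducible f" "f dvd f \<circ>\<^sub>p monom 1 r"
  defines "R \<equiv> {x. poly (map_poly to_ac f) x = 0}"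
  shows "bij_betw (\<lambda>x. x ^ r) R R"
proof -
  have f0: "f \<noteq> 0" using f(1) by (auto simp: irreducible_def)
  have fin: "finite R" unfolding R_def using f0 by (simp add: poly_roots_finite)
  obtain u where "f \<circ>\<^sub>p monom 1 r = f * u" using f(2) by (elim dvdE)
  then have u: "map_poly to_ac f \<circ>\<^sub>p monom 1 r = map_poly to_ac f * map_poly to_ac u"
    by (metis map_poly_to_ac_pcompose_monom map_poly_to_ac_mult)
  have sub: "(\<lambda>x. x ^ r) ` R \<subseteq> R"
  proof
    fix y assume "y \<in> (\<lambda>x. x ^ r) ` R"
    then obtain x where "x \<in> R" "y = x ^ r" by auto
    then show "y \<in> R"
      using arg_cong[OF u, of "\<lambda>p. poly p x"] by (simp add: R_def poly_pcompose poly_monom)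
  qed
  obtain z where "z \<in> R" using irreducible_imp_root[OF f(1)] by (auto simp: R_def)
  have "(\<lambda>x. x ^ r) ` R = R"
    unfolding R_def
  proof (rule irreducible_frobenius_stable_roots(1)[OF f(1)], goal_cases)
    case 1
    then show ?case using \<open>z \<in> R\<close> by (auto simp: R_def)
  next
    case 2
    then show ?case using sub by (simp add: R_def)
  next
    case 3
    have "(x ^ r) ^ CARD('a) = (x ^ CARD('a)) ^ r" for x :: "'a alg_closure"
      by (simp add: mult.commute flip: power_mult)
    then show ?case by (auto simp: poly_frobenius)
  qed
  then show ?thesis using fin by (simp add: bij_betw_def eq_card_imp_inj_on)
qed

text \<open>Both sides are compared after multiplication by f(X^(r^k)). Root by root, the cyclotomic
  part times the binomial for r^k is the binomial for r^(k+1).\<close>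

lemma composed_mult_cyclotomic_prime_power:
  fixes f G :: "'a :: finite_field poly"
  assumes r: "prime r" and f: "irreducible f" "poly f 0 \<noteq> 0" "f dvd f \<circ>\<^sub>p monom 1 r"
    and G: "G * (f \<circ>\<^sub>p monom 1 (r ^ k)) = f \<circ>\<^sub>p monom 1 (r ^ Suc k)"
  shows "map_poly to_ac G = f \<odot> cyclotomic_over (r ^ Suc k)"
proof -
  define R where "R = {x. poly (map_poly to_ac f) x = 0}"
  define P where "P = (cyclotomic_over (r ^ Suc k) :: 'a alg_closure poly)"
  let ?Q = "\<lambda>i. monom 1 (r ^ i) - 1 :: 'a alg_closure poly"
  have rpos: "r ^ i > 0" for i using r prime_gt_0_nat by simp
  have f0: "f \<noteq> 0" using f(1) by (auto simp: irreducible_def)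
  have fin: "finite R" unfolding R_def using f0 by (simp add: poly_roots_finite)
  obtain c where c: "c \<noteq> 0" "map_poly to_ac f = smult c (\<Prod>x\<in>R. [:-x, 1:])"
    unfolding R_def using irreducible_eq_prod_roots[OF f(1)] .
  have "poly (map_poly to_ac f) (to_ac 0) = to_ac (poly f 0)"
    by (rule poly_map_poly_hom) auto
  then have nz: "a \<noteq> 0" if "a \<in> R" for a using that f(2) by (auto simp: R_def)
  \<comment> \<open>Simplicity of the roots lets the outer product of the composed multiplication
    run over the set \<open>R\<close>.\<close>
  have "proots (map_poly to_ac f) = (\<Sum>x\<in>R. {#x#})"
    unfolding c(2) using c(1) by (simp add: proots_prod)
  then have proots_f: "proots (map_poly to_ac f) = mset_set R" by (simp add: sum_multiset_singleton)
  have Q0: "?Q i \<noteq> 0" for i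
    using degree_monom_minus_1(1)[OF rpos, of i, where ?'a = "'a alg_closure"] rpos[of i]
    by (metis degree_0 less_numeral_extra(3))
  have PQ: "P * ?Q k = ?Q (Suc k)"
    unfolding P_def by (rule cyclotomic_over_prime_power[OF r])
  then have P0: "P \<noteq> 0" using Q0[of "Suc k"] by auto
  have proots_PQ: "proots (?Q (Suc k)) = proots P + proots (?Q k)"
    unfolding PQ[symmetric] by (rule proots_mult[OF P0 Q0])
  have bij: "bij_betw (\<lambda>x. x ^ (r ^ i)) R R" for i
  proof (induction i)
    case (Suc i)
    have "bij_betw ((\<lambda>x. x ^ r) \<circ> (\<lambda>x. x ^ (r ^ i))) R R"
      by (rule bij_betw_trans[OF Suc]) (unfold R_def, rule bij_betw_power_roots[OF f(1,3)])
    then show ?case by (simp add: o_def mult.commute flip: power_mult)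
  qed (simp add: bij_betw_def)
  \<comment> \<open>Substitution produces X^m - a, whereas roots of unity produce X^m - a^m; the
    permutation \<open>bij\<close> of the roots reconciles the two products.\<close>
  have pow: "smult c (\<Prod>a\<in>R. monom 1 (r ^ i) - [:a ^ (r ^ i):]) = map_poly to_ac f \<circ>\<^sub>p monom 1 (r ^ i)" for i
  proof -
    have "(\<Prod>a\<in>R. monom 1 (r ^ i) - [:a ^ (r ^ i):]) = (\<Prod>a\<in>R. monom 1 (r ^ i) - [:a:])"
      by (rule prod.reindex_bij_betw[OF bij])
    then show ?thesis
      by (simp add: c(2) pcompose_smult pcompose_prod linear_pcompose_monom)
  qed
  have comp: "f \<odot> cyclotomic_over (r ^ Suc k) = (\<Prod>a\<in>R. \<Prod>b\<in>#proots P. [:-(a * b), 1:])"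
    unfolding composed_mult_def map_poly_to_ac_cyclotomic_over proots_f
    by (simp add: P_def prod_unfold_prod_mset)
  have "(f \<odot> cyclotomic_over (r ^ Suc k)) * (\<Prod>a\<in>R. monom 1 (r ^ k) - [:a ^ (r ^ k):])
    = (\<Prod>a\<in>R. monom 1 (r ^ Suc k) - [:a ^ (r ^ Suc k):])"
  proof -
    have "(\<Prod>b\<in>#proots P. [:-(a * b), 1:]) * (monom 1 (r ^ k) - [:a ^ (r ^ k):])
        = monom 1 (r ^ Suc k) - [:a ^ (r ^ Suc k):]" if "a \<in> R" for a
      unfolding prod_mset_scaled_roots_of_unity[OF nz[OF that] rpos, symmetric] proots_PQ by simp
    then show ?thesis
      unfolding comp prod.distrib[symmetric] by (rule prod.cong[OF refl])
  qed
  then have "(f \<odot> cyclotomic_over (r ^ Suc k)) * (map_poly to_ac f \<circ>\<^sub>p monom 1 (r ^ k))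
    = map_poly to_ac f \<circ>\<^sub>p monom 1 (r ^ Suc k)"
    unfolding pow[symmetric] by (simp del: power_Suc)
  also have "\<dots> = map_poly to_ac G * (map_poly to_ac f \<circ>\<^sub>p monom 1 (r ^ k))"
    unfolding map_poly_to_ac_pcompose_monom[symmetric] G[symmetric] map_poly_to_ac_mult ..
  finally show ?thesis
    using f0 rpos[of k] by (auto simp: pcompose_eq_0_iff degree_monom_eq)
qed

lemma degree_pcompose_monom:
  "degree (p \<circ>\<^sub>p monom (1 :: 'a :: idom) m) = degree p * m"
  by (simp add: degree_pcompose degree_monom_eq)

text \<open>A primitive root modulo r^(k+1) has order r^k (r - 1), the totient. Multiplied by
  \<open>degree f\<close>, this is the degree of \<open>G\<close>, as the period criterion requires.
  Both claims of the theorem are instances, the first with \<open>k = 0\<close>.\<close>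

lemma composed_mult_cyclotomic_irreducible:
  fixes f F :: "'a :: finite_field poly"
  assumes r: "prime r" "residue_primroot (r ^ Suc k) CARD('a)"
    and f: "irreducible f" "poly f 0 \<noteq> 0" "f dvd f \<circ>\<^sub>p monom 1 r"
    and cop: "coprime (degree f) (r ^ k * (r - 1))"
  defines "G \<equiv> ((f \<circ>\<^sub>p monom 1 r) div f) \<circ>\<^sub>p monom 1 (r ^ k)"
  shows "map_poly to_ac G = f \<odot> cyclotomic_over (r ^ Suc k)"
    and "irreducible G"
    and "degree G = degree f * (r ^ k * (r - 1))"
proof -
  have r1: "r > 1" using r(1) prime_gt_1_nat by blast
  have f0: "f \<noteq> 0" using f(1) by (auto simp: irreducible_def)
  have "((f \<circ>\<^sub>p monom 1 r) div f) * f = f \<circ>\<^sub>p monom 1 r" using f(3) by simp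
  then have "G * (f \<circ>\<^sub>p monom 1 (r ^ k)) = f \<circ>\<^sub>p monom 1 r \<circ>\<^sub>p monom 1 (r ^ k)"
    by (simp add: G_def flip: pcompose_mult)
  also have "\<dots> = f \<circ>\<^sub>p monom 1 (r ^ Suc k)"
    by (simp add: monom_pcompose_monom flip: pcompose_assoc)
  finally have G: "G * (f \<circ>\<^sub>p monom 1 (r ^ k)) = f \<circ>\<^sub>p monom 1 (r ^ Suc k)" .
  show eq: "map_poly to_ac G = f \<odot> cyclotomic_over (r ^ Suc k)"
    by (rule composed_mult_cyclotomic_prime_power[OF r(1) f G])
  have "f \<circ>\<^sub>p monom 1 (r ^ Suc k) \<noteq> 0" "f \<circ>\<^sub>p monom 1 (r ^ k) \<noteq> 0"
    using f0 r1 by (auto simp: pcompose_eq_0_iff degree_monom_eq simp del: power_Suc)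
  then have "degree G + degree f * r ^ k = degree f * r ^ Suc k"
    using arg_cong[OF G, of degree] G by (metis degree_mult_eq degree_pcompose_monom mult_eq_0_iff)
  then show deg: "degree G = degree f * (r ^ k * (r - 1))"
    using r1 by (simp add: algebra_simps diff_mult_distrib2)
  define P where "P = (cyclotomic_over (r ^ Suc k) :: 'a alg_closure poly)"
  have PQ: "P * (monom 1 (r ^ k) - 1) = monom 1 (r ^ Suc k) - 1"
    unfolding P_def by (rule cyclotomic_over_prime_power[OF r(1)])
  have degQ: "degree (monom 1 (r ^ i) - 1 :: 'a alg_closure poly) = r ^ i" for i
    using r1 by (intro degree_monom_minus_1) simp
  have nz: "P \<noteq> 0" 
    using PQ degQ[of "Suc k"] r1 by auto
  \<comment> \<open>A constant \<open>P\<close> would give the two binomials in \<open>PQ\<close>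
    equal degrees; so \<open>P\<close> has a root \<open>z\<close>.\<close>
  have "degree P \<noteq> 0"
  proof
    assume "degree P = 0"
    then obtain b where "P = [:b:]" by (rule degree_eq_zeroE)
    then have "r ^ Suc k = r ^ k"
      using arg_cong[OF PQ, of degree] degQ[of k] degQ[of "Suc k"] nz by (simp del: power_Suc)
    then show False using r1 by simp
  qed
  then obtain z where z: "poly P z = 0" using alg_closed_imp_poly_has_root[of P] by auto
  obtain a where a: "poly (map_poly to_ac f) a = 0" using irreducible_imp_root[OF f(1)] .
  have "poly (map_poly to_ac f) (to_ac 0) = to_ac (poly f 0)"
    by (rule poly_map_poly_hom) auto
  then have a0: "a \<noteq> 0" using a f(2) by auto
  have copq: "coprime (r ^ Suc k) CARD('a)" using r(2) by (simp add: residue_primroot_def)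
  \<comment> \<open>Otherwise the characteristic would be a common prime divisor of \<open>r\<close>
    and \<open>CARD('a)\<close>.\<close>
  have "of_nat r \<noteq> (0 :: 'a)"
  proof
    assume "of_nat r = (0 :: 'a)"
    then have "CHAR('a) dvd r" by (simp add: of_nat_eq_0_iff_char_dvd)
    then have "CHAR('a) dvd r ^ Suc k" by simp
    moreover have "CHAR('a) dvd CARD('a)" by (rule CHAR_dvd_CARD)
    ultimately have "is_unit CHAR('a)" using copq coprime_common_divisor by blast
    then show False using CHAR_prime[where 'a = 'a] by (metis not_prime_unit)
  qed
  then have "of_nat r \<noteq> (0 :: 'a alg_closure)"
    by (metis to_ac_of_nat to_ac_eq_0_iff)
  from root_cyclotomic_over_prime_power[OF r(1) this z[unfolded P_def]]
  have zord: "z ^ e = 1 \<longleftrightarrow> r ^ Suc k dvd e" for e .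
  have ordq: "ord (r ^ Suc k) CARD('a) = r ^ k * (r - 1)"
    using r by (simp add: residue_primroot_def totient_prime_power del: power_Suc)
  have "poly (map_poly to_ac G) (a * z) = 0"
  proof -
    have "a \<in># proots (map_poly to_ac f)" "z \<in># proots P"
      using a z f0 nz by simp_all
    then show ?thesis
      unfolding eq composed_mult_def map_poly_to_ac_cyclotomic_over P_def[symmetric]
      by (auto simp: poly_prod_mset prod_mset_zero_iff image_iff)
  qed
  from irreducible_composed_product[OF f(1) a a0 zord _ copq _ this]
  show "irreducible G" using cop r1 deg by (simp add: ordq del: power_Suc)
qed

theorem theorem2p7:
  fixes f :: "'a :: finite_field poly" and q r n :: nat
  assumes "CARD('a) = q"
    and "prime r"
    and "irreducible f"
    and "degree f = n"
    and "poly f 0 \<noteq> 0"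
    and "f dvd f \<circ>\<^sub>p monom 1 r"
    and "residue_primroot r q"
    and "gcd n (r - 1) = 1"
  shows "let F = (f \<circ>\<^sub>p monom 1 r) div f in
     (map_poly to_ac F = f \<odot> cyclotomic_over r \<and> irreducible F \<and> degree F = n * (r - 1)) \<and>
     (odd r \<and> \<not> r ^ 2 dvd q ^ (r - 1) - 1 \<and> gcd n (r * (r - 1)) = 1 \<longrightarrow>
       (\<forall>k. map_poly to_ac (F \<circ>\<^sub>p monom 1 (r ^ k)) = f \<odot> cyclotomic_over (r ^ (k + 1)) \<and>
            irreducible (F \<circ>\<^sub>p monom 1 (r ^ k)) \<and>
            degree (F \<circ>\<^sub>p monom 1 (r ^ k)) = n * r ^ k * (r - 1)))"
proof -
  define F where "F = (f \<circ>\<^sub>p monom 1 r) div f"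
  have "F \<circ>\<^sub>p monom 1 (r ^ 0) = F"
    by (simp add: monom_Suc monom_0)
  then have a: "map_poly to_ac F = f \<odot> cyclotomic_over r \<and> irreducible F \<and> degree F = n * (r - 1)"
    using composed_mult_cyclotomic_irreducible[of r 0 f] assms
    by (simp add: F_def coprime_iff_gcd_eq_1)
  have b: "map_poly to_ac (F \<circ>\<^sub>p monom 1 (r ^ k)) = f \<odot> cyclotomic_over (r ^ (k + 1)) \<and>
            irreducible (F \<circ>\<^sub>p monom 1 (r ^ k)) \<and>
            degree (F \<circ>\<^sub>p monom 1 (r ^ k)) = n * r ^ k * (r - 1)"
    if "odd r" "\<not> r ^ 2 dvd q ^ (r - 1) - 1" "gcd n (r * (r - 1)) = 1" for k
  proof -
    have "q > 0" using assms(1) by auto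
    \<comment> \<open>This is the classical condition under which a primitive root modulo an odd
      prime stays primitive modulo all its powers.\<close>
    then have "[q ^ (r - 1) \<noteq> 1] (mod r\<^sup>2)"
      using that(2) by (simp add: cong_altdef_nat)
    then have "residue_primroot (r ^ Suc k) q"
      using residue_primroot_prime_lift_iff[OF assms(2) that(1) assms(7)] by blast
    moreover have "coprime n (r ^ k * (r - 1))"
      using that(3) unfolding coprime_iff_gcd_eq_1[symmetric] by simp
    ultimately show ?thesis
      using composed_mult_cyclotomic_irreducible[of r k f] assms
      by (simp add: F_def mult.assoc)
  qed
  show ?thesis
    unfolding Let_def F_def[symmetric] by (rule conjI[OF a], intro impI allI, rule b) simp_all
qed

end
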